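(* (1) For all constants $a,A>0$ there exist constants $c>0$ and $N$ such that for all integers $n\ge N$ and all integers $m$ with $a\ln n\le m\le A n^{1/4}$, there exist a family of instances $(\mu^\star,\sigma_1,\dots,\sigma_n)$ with $\sigma_{(m)}\le 1$ and a probability distribution over this family such that every estimator $\hat\mu=\hat\mu(x_1,\dots,x_n)$ has expected error $$\mathbb{E}\,|\hat\mu-\mu^\star|\ \ge\ c\left(\frac{n}{m^4}\right)^{1/2}.$$ (2) For every (arbitrarily small) $\epsilon>0$ and all constants $a,A>0$ there exist constants $c>0$ and $N$ such that for all integers $n\ge N$ and all integers $m$ with $a n^{1/4}\le m\le A n^{1-\epsilon}$, there exist a family of instances $(\mu^\star,\sigma_1,\dots,\sigma_n)$ with $\sigma_{(m)}\le 1$ and a probability distribution over this family such that every estimator $\hat\mu=\hat\mu(x_1,\dots,x_n)$ has expected error $$\mathbb{E}\,|\hat\mu-\mu^\star|\ \ge\ c\left(\frac{n}{m^4}\right)^{1/6}.$$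
   Context: An instance consists of a mean $\mu^\star\in\mathbb{R}$ and standard deviations $\sigma_1,\dots,\sigma_n>0$; $\sigma_{(m)}$ denotes the $m$-th smallest value among $\sigma_1,\dots,\sigma_n$. Given an instance, the samples $x_1,\dots,x_n$ are independent with $x_i\sim\mathcal{N}(\mu^\star,\sigma_i^2)$. An estimator is a measurable function of $(x_1,\dots,x_n)$ only (the mean and all variances are unknown to it). The expectation $\mathbb{E}$ is over both the random choice of the instance from the distribution and the samples given the instance. *)

theory Defs
  imports "HOL-Probability.Probability"
begin

text \<open>
  An instance with \<open>n\<close> samples is a pair \<open>(\<mu>, \<sigma>)\<close>, where \<open>\<sigma>\<close> is a function on the index set
  \<open>{1..n}\<close> (and \<open>undefined\<close> elsewhere, as always for elements of \<open>space (Pi\<^sub>M {1..n} _)\<close>).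
\<close>

definition instance_space :: "nat \<Rightarrow> (real \<times> (nat \<Rightarrow> real)) measure" where
  "instance_space n = borel \<Otimes>\<^sub>M (Pi\<^sub>M {1..n} (\<lambda>_. borel))"

definition instances :: "nat \<Rightarrow> (real \<times> (nat \<Rightarrow> real)) set" where
  "instances n = {(\<mu>, \<sigma>) \<in> space (instance_space n). \<forall>i\<in>{1..n}. \<sigma> i > 0}"

text \<open>The \<open>m\<close>-th smallest of \<open>\<sigma> 1, \<dots>, \<sigma> n\<close>, counted with multiplicity; meaningful for \<open>1 \<le> m \<le> n\<close>.\<close>

definition order_stat :: "nat \<Rightarrow> (nat \<Rightarrow> real) \<Rightarrow> nat \<Rightarrow> real" where
  "order_stat n \<sigma> m = sort (map \<sigma> [1..<Suc n]) ! (m - 1)"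

text \<open>The parameter \<open>\<sigma> i\<close> of \<^const>\<open>normal_density\<close> is the standard deviation, not the variance.\<close>

definition sample_measure :: "nat \<Rightarrow> real \<Rightarrow> (nat \<Rightarrow> real) \<Rightarrow> (nat \<Rightarrow> real) measure" where
  "sample_measure n \<mu> \<sigma> = Pi\<^sub>M {1..n} (\<lambda>i. density lborel (normal_density \<mu> (\<sigma> i)))"

text \<open>
  A distribution over a family \<open>F\<close>: a probability measure whose underlying space is \<open>F\<close> itself,
  with the trace of the product Borel \<open>\<sigma>\<close>-algebra.
\<close>

definition distribution_on ::
    "nat \<Rightarrow> (real \<times> (nat \<Rightarrow> real)) set \<Rightarrow> (real \<times> (nat \<Rightarrow> real)) measure \<Rightarrow> bool" where
  "distribution_on n F D \<longleftrightarrow>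
     prob_space D \<and> space D = F \<and> sets D = sets (restrict_space (instance_space n) F)"

abbreviation estimator :: "nat \<Rightarrow> ((nat \<Rightarrow> real) \<Rightarrow> real) \<Rightarrow> bool" where
  "estimator n est \<equiv> est \<in> borel_measurable (Pi\<^sub>M {1..n} (\<lambda>_. borel))"

text \<open>
  The expectation over the instance and then the samples given the instance. It takes values in
  \<^typ>\<open>ennreal\<close>, so an estimator whose error is not integrable has expected error \<open>\<infinity>\<close>, not \<open>0\<close>.
\<close>

definition expected_error ::
    "nat \<Rightarrow> (real \<times> (nat \<Rightarrow> real)) measure \<Rightarrow> ((nat \<Rightarrow> real) \<Rightarrow> real) \<Rightarrow> ennreal" where
  "expected_error n D est =
     (\<integral>\<^sup>+ (\<mu>, \<sigma>). (\<integral>\<^sup>+ x. ennreal \<bar>est x - \<mu>\<bar> \<partial>sample_measure n \<mu> \<sigma>) \<partial>D)"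

end

theory Submission
  imports Defs "HOL-Real_Asymp.Real_Asymp"
begin

text \<open>
  The prior takes the mean in \<open>{0, \<Delta>}\<close> with equal probability and the standard deviations
  independently equal to \<open>1\<close> with probability \<open>4 m / n\<close> and to \<open>R\<close> otherwise, conditioned on at
  least \<open>m\<close> of them being \<open>1\<close>. Without the conditioning, which changes little, the samples are
  i.i.d. from a two-component Gaussian mixture. Bounding the denominator from below by the wide
  component, the \<open>\<chi>\<^sup>2\<close>-divergence between the mixtures with means \<open>\<Delta>\<close> and \<open>0\<close> is of order
  \<open>(m / n)\<^sup>2 R min 1 \<Delta>\<^sup>2 + \<Delta>\<^sup>2 / R\<^sup>2\<close>. If this is \<open>O(1 / n)\<close> with a small constant, then the
  laws of the \<open>n\<close> samples overlap and every estimator has error of order \<open>\<Delta>\<close>. Take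
  \<open>\<Delta> = R / (64 \<surd>n)\<close>, with \<open>R\<close> of order \<open>n / m\<^sup>2\<close> in part (1) and \<open>R\<close> equal to \<open>(n / m)\<close> to the
  power \<open>2 / 3\<close> in part (2).
\<close>

section \<open>Densities of finite product measures\<close>

text \<open>Measurable boxes determine a finite product of sigma-finite measures, and on a box the
  integral of the product density factorizes.\<close>

lemma PiM_density_lborel:
  fixes f :: "'i \<Rightarrow> real \<Rightarrow> real"
  assumes fin: "finite I" and meas [measurable]: "\<And>i. i \<in> I \<Longrightarrow> f i \<in> borel_measurable borel"
    and nn: "\<And>i x. i \<in> I \<Longrightarrow> 0 \<le> f i x"
    and prob: "\<And>i. i \<in> I \<Longrightarrow> prob_space (density lborel (f i))"
  shows "Pi\<^sub>M I (\<lambda>i. density lborel (f i)) =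
    density (Pi\<^sub>M I (\<lambda>_. lborel)) (\<lambda>x. ennreal (\<Prod>i\<in>I. f i (x i)))"
proof -
  \<comment> \<open>\<open>product_sigma_finite\<close> asks for sigma-finiteness at every index, so
    the family is continued by \<open>lborel\<close> outside \<open>I\<close>.\<close>
  define g where "g i = (if i \<in> I then density lborel (f i) else lborel)" for i
  have sf: "product_sigma_finite g"
    using prob by (auto simp: g_def product_sigma_finite_def prob_space_imp_sigma_finite
        intro: lborel.sigma_finite_measure_axioms)
  have *: "Pi\<^sub>M I (\<lambda>i. density lborel (f i)) = Pi\<^sub>M I g"
    by (intro PiM_cong) (auto simp: g_def)
  interpret L: product_sigma_finite "\<lambda>_::'i. lborel :: real measure"
    by unfold_locales
  have "density (Pi\<^sub>M I (\<lambda>_. lborel)) (\<lambda>x. ennreal (\<Prod>i\<in>I. f i (x i))) = Pi\<^sub>M I g"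
  proof (rule product_sigma_finite.PiM_eqI[OF sf fin])
    show "sets (density (Pi\<^sub>M I (\<lambda>_. lborel)) (\<lambda>x. ennreal (\<Prod>i\<in>I. f i (x i)))) = sets (Pi\<^sub>M I g)"
      by (simp, intro sets_PiM_cong) (auto simp: g_def)
  next
    fix A assume "\<And>i. i \<in> I \<Longrightarrow> A i \<in> sets (g i)"
    then have A [measurable]: "A i \<in> sets borel" if "i \<in> I" for i
      using that by (force simp: g_def)
    have box: "Pi\<^sub>E I A \<in> sets (Pi\<^sub>M I (\<lambda>_. lborel :: real measure))"
      using fin A by (intro sets_PiM_I_finite) auto
    have m: "(\<lambda>x. ennreal (\<Prod>i\<in>I. f i (x i))) \<in> borel_measurable (Pi\<^sub>M I (\<lambda>_. lborel))"
      by measurable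
    have "emeasure (density (Pi\<^sub>M I (\<lambda>_. lborel)) (\<lambda>x. ennreal (\<Prod>i\<in>I. f i (x i)))) (Pi\<^sub>E I A) =
        (\<integral>\<^sup>+x. ennreal (\<Prod>i\<in>I. f i (x i)) * indicator (Pi\<^sub>E I A) x \<partial>Pi\<^sub>M I (\<lambda>_. lborel))"
      by (rule emeasure_density[OF m box])
    also have "\<dots> = (\<integral>\<^sup>+x. (\<Prod>i\<in>I. ennreal (f i (x i)) * indicator (A i) (x i)) \<partial>Pi\<^sub>M I (\<lambda>_. lborel))"
    proof (rule nn_integral_cong)
      fix x assume "x \<in> space (Pi\<^sub>M I (\<lambda>_. lborel :: real measure))"
      then have e: "x \<in> extensional I" by (auto simp: space_PiM PiE_def)
      have "indicator (Pi\<^sub>E I A) x = (\<Prod>i\<in>I. indicator (A i) (x i) :: ennreal)"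
      proof (cases "x \<in> Pi\<^sub>E I A")
        case True
        then show ?thesis by (auto simp: PiE_def Pi_def intro!: prod.neutral[symmetric])
      next
        case False
        then obtain i where "i \<in> I" "x i \<notin> A i" using e by (auto simp: PiE_def)
        then show ?thesis using False fin by (auto simp: indicator_def intro!: prod_zero[symmetric])
      qed
      then show "ennreal (\<Prod>i\<in>I. f i (x i)) * indicator (Pi\<^sub>E I A) x =
          (\<Prod>i\<in>I. ennreal (f i (x i)) * indicator (A i) (x i))"
        using nn by (simp add: prod.distrib prod_ennreal)
    qed
    also have "\<dots> = (\<Prod>i\<in>I. \<integral>\<^sup>+y. ennreal (f i y) * indicator (A i) y \<partial>lborel)"
      using fin by (intro L.product_nn_integral_prod) auto
    also have "\<dots> = (\<Prod>i\<in>I. emeasure (g i) (A i))"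
      by (intro prod.cong refl) (simp add: g_def emeasure_density)
    finally show "emeasure (density (Pi\<^sub>M I (\<lambda>_. lborel)) (\<lambda>x. ennreal (\<Prod>i\<in>I. f i (x i)))) (Pi\<^sub>E I A) =
        (\<Prod>i\<in>I. emeasure (g i) (A i))" .
  qed
  then show ?thesis using * by simp
qed

lemma product_sigma_finite_lborel: "product_sigma_finite (\<lambda>_::nat. lborel :: real measure)"
  by (auto simp: product_sigma_finite_def intro: lborel.sigma_finite_measure_axioms)

lemma sample_measure_eq_density:
  assumes "\<And>i. i \<in> {1..n} \<Longrightarrow> 0 < \<sigma> i"
  shows "sample_measure n \<mu> \<sigma> =
    density (Pi\<^sub>M {1..n} (\<lambda>_. lborel)) (\<lambda>x. ennreal (\<Prod>i\<in>{1..n}. normal_density \<mu> (\<sigma> i) (x i)))"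
  unfolding sample_measure_def
  by (rule PiM_density_lborel) (use assms in \<open>auto intro: prob_space_normal_density\<close>)

section \<open>Gaussian integrals for the \<chi>^2-divergence\<close>

text \<open>Completing the square in the combined exponent. Comparing coefficients of x^2 forces
  \<open>eq\<close>; what remains is a constant times a normal density with standard deviation
  \<open>v\<close>.\<close>

lemma normal_density_mult_div:
  assumes \<tau>: "\<tau> > 0" and R: "R > 0" and v: "v > 0"
    and eq: "1 / v\<^sup>2 = 2 / \<tau>\<^sup>2 - 1 / R\<^sup>2"
  shows "normal_density a \<tau> x * normal_density b \<tau> x / normal_density 0 R x =
    R * v / \<tau>\<^sup>2 * exp ((a + b)\<^sup>2 * v\<^sup>2 / (2 * \<tau>^4) - (a\<^sup>2 + b\<^sup>2) / (2 * \<tau>\<^sup>2))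
      * normal_density ((a + b) * v\<^sup>2 / \<tau>\<^sup>2) v x"
proof -
  have sq: "1 / sqrt (2 * pi * t\<^sup>2) = 1 / (sqrt (2 * pi) * t)" if "t > 0" for t
    using that by (simp add: real_sqrt_mult)
  have c: "1 / (sqrt (2*pi) * \<tau>) * (1 / (sqrt (2*pi) * \<tau>)) / (1 / (sqrt (2*pi) * R)) =
      R * v / \<tau>\<^sup>2 * (1 / (sqrt (2*pi) * v))"
    using \<tau> R v by (simp add: field_simps power2_eq_square)
  have e: "- (x - a)\<^sup>2 / (2 * \<tau>\<^sup>2) + - (x - b)\<^sup>2 / (2 * \<tau>\<^sup>2) - - (x - 0)\<^sup>2 / (2 * R\<^sup>2) =
      ((a + b)\<^sup>2 * v\<^sup>2 / (2 * \<tau>^4) - (a\<^sup>2 + b\<^sup>2) / (2 * \<tau>\<^sup>2)) +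
      - (x - (a + b) * v\<^sup>2 / \<tau>\<^sup>2)\<^sup>2 / (2 * v\<^sup>2)"
  proof -
    have "- (x - a)\<^sup>2 / (2 * \<tau>\<^sup>2) + - (x - b)\<^sup>2 / (2 * \<tau>\<^sup>2) - - (x - 0)\<^sup>2 / (2 * R\<^sup>2) =
      - x\<^sup>2 * (2 / \<tau>\<^sup>2 - 1 / R\<^sup>2) / 2 + (a + b) * x / \<tau>\<^sup>2 - (a\<^sup>2 + b\<^sup>2) / (2 * \<tau>\<^sup>2)"
      using \<tau> R by (simp add: field_simps power2_eq_square)
    also have "\<dots> = - x\<^sup>2 * (1 / v\<^sup>2) / 2 + (a + b) * x / \<tau>\<^sup>2 - (a\<^sup>2 + b\<^sup>2) / (2 * \<tau>\<^sup>2)"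
      using eq by simp
    also have "\<dots> = ((a + b)\<^sup>2 * v\<^sup>2 / (2 * \<tau>^4) - (a\<^sup>2 + b\<^sup>2) / (2 * \<tau>\<^sup>2)) +
      - (x - (a + b) * v\<^sup>2 / \<tau>\<^sup>2)\<^sup>2 / (2 * v\<^sup>2)"
      using \<tau> v by (simp add: field_simps power2_eq_square power4_eq_xxxx)
    finally show ?thesis .
  qed
  have "normal_density a \<tau> x * normal_density b \<tau> x / normal_density 0 R x =
     (1 / (sqrt (2*pi) * \<tau>) * (1 / (sqrt (2*pi) * \<tau>)) / (1 / (sqrt (2*pi) * R))) *
     exp (- (x - a)\<^sup>2 / (2 * \<tau>\<^sup>2) + - (x - b)\<^sup>2 / (2 * \<tau>\<^sup>2) - - (x - 0)\<^sup>2 / (2 * R\<^sup>2))"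
    unfolding normal_density_def sq[OF \<tau>] sq[OF R] exp_add exp_diff by simp
  then show ?thesis
    unfolding c e normal_density_def sq[OF v] exp_add by (simp add: mult_ac)
qed

text \<open>Expanding the square leaves quotients as in \<open>normal_density_mult_div\<close> for
  the pairs of means (a, a), (0, 0) and (a, 0). Each of them integrates to its constant
  factor.\<close>

lemma
  assumes \<tau>: "\<tau> > 0" and R: "R > 0" and v: "v > 0"
    and eq: "1 / v\<^sup>2 = 2 / \<tau>\<^sup>2 - 1 / R\<^sup>2"
  shows integrable_normal_density_diff_sq:
      "integrable lborel (\<lambda>x. (normal_density a \<tau> x - normal_density 0 \<tau> x)\<^sup>2 / normal_density 0 R x)"
    and integral_normal_density_diff_sq:
      "(\<integral>x. (normal_density a \<tau> x - normal_density 0 \<tau> x)\<^sup>2 / normal_density 0 R x \<partial>lborel) =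
        R * v / \<tau>\<^sup>2 * (exp (a\<^sup>2 * (2 * v\<^sup>2 - \<tau>\<^sup>2) / \<tau>^4) + 1 - 2 * exp (- a\<^sup>2 * (\<tau>\<^sup>2 - v\<^sup>2) / (2 * \<tau>^4)))"
proof -
  let ?K = "\<lambda>a b. R * v / \<tau>\<^sup>2 * exp ((a + b)\<^sup>2 * v\<^sup>2 / (2 * \<tau>^4) - (a\<^sup>2 + b\<^sup>2) / (2 * \<tau>\<^sup>2))"
  let ?N = "\<lambda>a b. normal_density ((a + b) * v\<^sup>2 / \<tau>\<^sup>2) v"
  note * = normal_density_mult_div[OF \<tau> R v eq]
  have fn: "(\<lambda>x. (normal_density a \<tau> x - normal_density 0 \<tau> x)\<^sup>2 / normal_density 0 R x) =
      (\<lambda>x. ?K a a * ?N a a x + ?K 0 0 * ?N 0 0 x - 2 * (?K a 0 * ?N a 0 x))"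
    unfolding *[symmetric]
    by (rule ext) (simp add: power2_eq_square algebra_simps add_divide_distrib diff_divide_distrib)
  have hbi: "has_bochner_integral lborel (\<lambda>x. ?K a b * ?N a b x) (?K a b)" for a b
    using has_bochner_integral_mult_right[OF has_bochner_integral_integrable[OF integrable_normal_density[OF v]],
        of "?K a b"] unfolding integral_normal_density[OF v] mult_1_right by blast
  have hb: "has_bochner_integral lborel
      (\<lambda>x. (normal_density a \<tau> x - normal_density 0 \<tau> x)\<^sup>2 / normal_density 0 R x)
      (?K a a + ?K 0 0 - 2 * ?K a 0)"
    unfolding fn
    by (intro has_bochner_integral_add has_bochner_integral_diff has_bochner_integral_mult_right hbi)
  then show "integrable lborel (\<lambda>x. (normal_density a \<tau> x - normal_density 0 \<tau> x)\<^sup>2 / normal_density 0 R x)"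
    by (rule integrable.intros)
  have "(a + a)\<^sup>2 * v\<^sup>2 / (2 * \<tau>^4) - (a\<^sup>2 + a\<^sup>2) / (2 * \<tau>\<^sup>2) = a\<^sup>2 * (2 * v\<^sup>2 - \<tau>\<^sup>2) / \<tau>^4"
    using \<tau> by (simp add: field_simps power2_eq_square power4_eq_xxxx)
  moreover have "(a + 0)\<^sup>2 * v\<^sup>2 / (2 * \<tau>^4) - (a\<^sup>2 + 0\<^sup>2) / (2 * \<tau>\<^sup>2) = - a\<^sup>2 * (\<tau>\<^sup>2 - v\<^sup>2) / (2 * \<tau>^4)"
    using \<tau> by (simp add: field_simps power2_eq_square power4_eq_xxxx)
  ultimately have K: "?K a a + ?K 0 0 - 2 * ?K a 0 =
     R * v / \<tau>\<^sup>2 * (exp (a\<^sup>2 * (2 * v\<^sup>2 - \<tau>\<^sup>2) / \<tau>^4) + 1 - 2 * exp (- a\<^sup>2 * (\<tau>\<^sup>2 - v\<^sup>2) / (2 * \<tau>^4)))"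
    by (simp add: algebra_simps)
  show "(\<integral>x. (normal_density a \<tau> x - normal_density 0 \<tau> x)\<^sup>2 / normal_density 0 R x \<partial>lborel) =
        R * v / \<tau>\<^sup>2 * (exp (a\<^sup>2 * (2 * v\<^sup>2 - \<tau>\<^sup>2) / \<tau>^4) + 1 - 2 * exp (- a\<^sup>2 * (\<tau>\<^sup>2 - v\<^sup>2) / (2 * \<tau>^4)))"
    using has_bochner_integral_integral_eq[OF hb] unfolding K .
qed

section \<open>Order statistics and elementary inequalities\<close>

text \<open>If entry \<open>m - 1\<close> of the sorted list exceeded \<open>t\<close>, all values
  up to \<open>t\<close> would sit at earlier positions, and there are only \<open>m - 1\<close> of
  those.\<close>

lemma order_stat_le:
  assumes "1 \<le> m" and "m \<le> card {i \<in> {1..n}. \<sigma> i \<le> t}"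
  shows "order_stat n \<sigma> m \<le> t"
proof (rule ccontr)
  let ?xs = "map \<sigma> [1..<Suc n]"
  assume "\<not> order_stat n \<sigma> m \<le> t"
  then have gt: "sort ?xs ! (m - 1) > t" by (simp add: order_stat_def del: upt_Suc)
  have "card {i \<in> {1..n}. \<sigma> i \<le> t} = length (filter (\<lambda>i. \<sigma> i \<le> t) [1..<Suc n])"
    by (subst distinct_card[symmetric])
      (auto simp del: upt_Suc intro!: arg_cong[where f=card])
  also have "\<dots> = length (filter (\<lambda>x. x \<le> t) (sort ?xs))"
    by (simp add: filter_sort filter_map o_def del: upt_Suc)
  also have "\<dots> = card {i. i < length (sort ?xs) \<and> sort ?xs ! i \<le> t}"
    by (rule length_filter_conv_card)
  also have "\<dots> \<le> card {..<m - 1}"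
  proof (intro card_mono subsetI)
    fix i assume i: "i \<in> {i. i < length (sort ?xs) \<and> sort ?xs ! i \<le> t}"
    show "i \<in> {..<m - 1}"
    proof (rule ccontr)
      assume "i \<notin> {..<m - 1}"
      then have "sort ?xs ! (m - 1) \<le> sort ?xs ! i"
        using i by (intro sorted_nth_mono) auto
      then show False using i gt by simp
    qed
  qed simp
  finally show False using assms by simp
qed

lemma exp_le_one_plus_double: "0 \<le> y \<Longrightarrow> y \<le> 1 \<Longrightarrow> exp y \<le> 1 + 2 * (y::real)"
proof -
  assume y: "0 \<le> y" "y \<le> 1"
  then have "exp y \<le> 1 + y + y\<^sup>2" by (rule exp_bound)
  moreover have "y\<^sup>2 \<le> y" using y by (simp add: power2_eq_square mult_left_le)
  ultimately show ?thesis by simp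
qed

text \<open>Meant for densities \<open>p\<close> and \<open>q\<close>, with \<open>e\<close> an
  upper bound for q^2 / p: the minimum gets a lower bound that is linear in \<open>p\<close>,
  \<open>q\<close> and \<open>e\<close>, hence easy to integrate. After multiplication by
  \<open>p\<close>, both cases reduce to a square being nonnegative.\<close>

lemma min_ge_of_sq_le:
  assumes "0 < p" "q\<^sup>2 \<le> e * p" shows "2 * q - e - p / 4 \<le> min p (q::real)"
proof -
  have "(q - e - p / 4) * p \<le> 0"
    using assms(2) zero_le_power2[of "q - p / 2"] by (simp add: power2_eq_square algebra_simps)
  moreover have "(2 * q - e - p / 4 - p) * p \<le> 0"
  proof -
    have "2 * (p * q) \<le> p * p + q * q" "q * q \<le> e * p" "0 \<le> p * p"
      using assms(2) zero_le_power2[of "q - p"] by (simp_all add: power2_eq_square algebra_simps)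
    moreover have "(2 * q - e - p / 4 - p) * p = 2 * (p * q) - e * p - 5 / 4 * (p * p)"
      by (simp add: algebra_simps)
    ultimately show ?thesis by linarith
  qed
  ultimately show ?thesis using assms(1) by (auto simp: mult_le_0_iff)
qed

text \<open>The left-hand side of \<open>chi\<close> bounds the \<open>\<chi>\<^sup>2\<close>-divergence between the laws of a single sample
  under the means \<open>\<Delta>\<close> and \<open>0\<close>. The factor \<open>4\<close> in \<open>4 * m / n\<close> makes at least \<open>m\<close> of the
  standard deviations equal to \<open>1\<close> with high probability.\<close>
locale two_scale_prior =
  fixes n m :: nat and R \<Delta> :: real
  assumes m4: "4 \<le> m" and mn: "8 * m \<le> n" and R: "1 < R" and \<Delta>0: "0 < \<Delta>" and \<Delta>R: "\<Delta> \<le> R"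
    and chi: "4 * (4 * real m / real n)\<^sup>2 * R * (2 * \<Delta>\<^sup>2 / R\<^sup>2 + min 2 (\<Delta>\<^sup>2)) + 4 * \<Delta>\<^sup>2 / R\<^sup>2 \<le> 1 / (16 * real n)"
begin

section \<open>The random standard deviations and the induced mixture\<close>

definition \<alpha> :: real where
  "\<alpha> = 4 * real m / real n"

lemma n_pos: "0 < n" using m4 mn by simp

lemma \<alpha>: "0 < \<alpha>" "\<alpha> \<le> 1 / 2"
proof -
  have "8 * real m \<le> real n" using mn by linarith
  then show "0 < \<alpha>" "\<alpha> \<le> 1 / 2" using m4 n_pos by (simp_all add: \<alpha>_def field_simps)
qed

definition scale_weight :: "real \<Rightarrow> real" where
  "scale_weight s = (if s = 1 then \<alpha> else 1 - \<alpha>)"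

definition configs :: "(nat \<Rightarrow> real) set" where
  "configs = Pi\<^sub>E {1..n} (\<lambda>_. {1, R})"

definition good :: "(nat \<Rightarrow> real) set" where
  "good = {\<sigma> \<in> configs. m \<le> card {i \<in> {1..n}. \<sigma> i = 1}}"

definition weight :: "(nat \<Rightarrow> real) \<Rightarrow> real" where
  "weight \<sigma> = (\<Prod>i\<in>{1..n}. scale_weight (\<sigma> i))"

definition lik :: "real \<Rightarrow> (nat \<Rightarrow> real) \<Rightarrow> (nat \<Rightarrow> real) \<Rightarrow> real" where
  "lik \<mu> \<sigma> x = (\<Prod>i\<in>{1..n}. normal_density \<mu> (\<sigma> i) (x i))"

definition mix :: "real \<Rightarrow> real \<Rightarrow> real" where
  "mix \<mu> x = \<alpha> * normal_density \<mu> 1 x + (1 - \<alpha>) * normal_density \<mu> R x"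

text \<open>An upper bound for the density ratio \<open>(mix \<Delta>)\<^sup>2 / mix 0\<close>, by keeping only the wide component
  of \<open>mix 0\<close> in the denominator of the \<open>\<chi>\<^sup>2\<close> integrand; its integral has a closed form.\<close>
definition envelope :: "real \<Rightarrow> real" where
  "envelope x = 2 * mix \<Delta> x - mix 0 x
    + 4 * \<alpha>\<^sup>2 * ((normal_density \<Delta> 1 x - normal_density 0 1 x)\<^sup>2 / normal_density 0 R x)
    + 2 * ((normal_density \<Delta> R x - normal_density 0 R x)\<^sup>2 / normal_density 0 R x)"

abbreviation prodM :: "(nat \<Rightarrow> real) measure" where
  "prodM \<equiv> Pi\<^sub>M {1..n} (\<lambda>_. lborel)"

lemma finite_configs [simp]: "finite configs"
  by (auto simp: configs_def intro!: finite_PiE)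

lemma good_subset: "good \<subseteq> configs" by (auto simp: good_def)

lemma finite_good [simp]: "finite good"
  using good_subset finite_configs by (rule finite_subset)

lemma configs_pos: "\<sigma> \<in> configs \<Longrightarrow> i \<in> {1..n} \<Longrightarrow> 0 < \<sigma> i"
  using R by (auto simp: configs_def PiE_def Pi_def dest!: bspec)

lemma scale_weight_pos: "0 < scale_weight s"
  using \<alpha> by (simp add: scale_weight_def)

lemma weight_pos: "0 < weight \<sigma>"
  unfolding weight_def by (intro prod_pos scale_weight_pos)

lemma lik_nonneg: "0 \<le> lik \<mu> \<sigma> x"
  unfolding lik_def by (intro prod_nonneg) simp

lemma mix_pos: "0 < mix \<mu> x"
  unfolding mix_def using \<alpha> R by (intro add_pos_pos mult_pos_pos normal_density_pos) auto

text \<open>Distributivity, with \<open>R \<noteq> 1\<close> making \<open>{1, R}\<close> a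
  two-element set. In terms of the prior, this is the independence of the standard
  deviations.\<close>

lemma sum_configs: "(\<Sum>\<sigma>\<in>configs. \<Prod>i\<in>{1..n}. f i (\<sigma> i)) = (\<Prod>i\<in>{1..n}. f i 1 + f i R :: real)"
proof -
  have "(\<Prod>i\<in>{1..n}. f i 1 + f i R) = (\<Prod>i\<in>{1..n}. \<Sum>s\<in>{1, R}. f i s)"
    using R by simp
  then show ?thesis
    by (simp add: configs_def prod_sum_PiE)
qed

text \<open>Averaging over independent standard deviations turns the samples into i.i.d. draws from
  the mixture.\<close>

lemma prod_mix: "(\<Prod>i\<in>{1..n}. mix \<mu> (x i)) = (\<Sum>\<sigma>\<in>configs. weight \<sigma> * lik \<mu> \<sigma> x)"
proof -
  have "(\<Prod>i\<in>{1..n}. mix \<mu> (x i)) = (\<Prod>i\<in>{1..n}. scale_weight 1 * normal_density \<mu> 1 (x i)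
      + scale_weight R * normal_density \<mu> R (x i))"
    using R by (simp add: mix_def scale_weight_def)
  also have "\<dots> = (\<Sum>\<sigma>\<in>configs. \<Prod>i\<in>{1..n}. scale_weight (\<sigma> i) * normal_density \<mu> (\<sigma> i) (x i))"
    by (rule sum_configs[where f = "\<lambda>i s. scale_weight s * normal_density \<mu> s (x i)", symmetric])
  finally show ?thesis
    by (simp only: weight_def lik_def prod.distrib)
qed

lemma sum_weight: "sum weight configs = 1"
  using sum_configs[of "\<lambda>_. scale_weight"] R by (simp add: weight_def[abs_def] scale_weight_def)

text \<open>Chernoff's method: if \<open>\<sigma>\<close> has \<open>k < m\<close> entries equal to \<open>1\<close>, then
  \<open>1 \<le> 2 ^ m * (1 / 2) ^ k\<close>, and the weighted sum of the right-hand side over all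
  configurations factorizes.\<close>
lemma weight_bad: "sum weight (configs - good) \<le> 1 / 16"
proof -
  let ?u = "\<lambda>s::real. if s = 1 then 1 / 2 else 1 :: real"
  have u: "weight \<sigma> \<le> 2 ^ m * (\<Prod>i\<in>{1..n}. scale_weight (\<sigma> i) * ?u (\<sigma> i))"
    if "\<sigma> \<in> configs - good" for \<sigma>
  proof -
    have "card {i \<in> {1..n}. \<sigma> i = 1} \<le> m" using that by (auto simp: good_def)
    moreover have "(\<Prod>i\<in>{1..n}. ?u (\<sigma> i)) = (1 / 2) ^ card {i \<in> {1..n}. \<sigma> i = 1}"
      by (simp add: prod.If_cases Int_def)
    ultimately have "(1 / 2) ^ m \<le> (\<Prod>i\<in>{1..n}. ?u (\<sigma> i))"
      by (simp add: power_decreasing)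
    then have "1 \<le> 2 ^ m * (\<Prod>i\<in>{1..n}. ?u (\<sigma> i))"
      by (simp add: power_divide field_simps)
    then show ?thesis
      using weight_pos[of \<sigma>] unfolding prod.distrib weight_def[symmetric]
      by (metis mult.left_commute mult_left_mono less_imp_le mult.right_neutral)
  qed
  have "sum weight (configs - good) \<le> (\<Sum>\<sigma>\<in>configs - good. 2 ^ m * (\<Prod>i\<in>{1..n}. scale_weight (\<sigma> i) * ?u (\<sigma> i)))"
    by (intro sum_mono u)
  also have "\<dots> \<le> (\<Sum>\<sigma>\<in>configs. 2 ^ m * (\<Prod>i\<in>{1..n}. scale_weight (\<sigma> i) * ?u (\<sigma> i)))"
    by (intro sum_mono2 mult_nonneg_nonneg prod_nonneg ballI)
       (auto intro: less_imp_le[OF scale_weight_pos])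
  also have "\<dots> = 2 ^ m * (\<Prod>i\<in>{1..n}. \<alpha> / 2 + (1 - \<alpha>))"
    unfolding sum_distrib_left[symmetric] sum_configs[where f = "\<lambda>_ s. scale_weight s * ?u s"]
    using R by (simp add: scale_weight_def)
  also have "\<dots> = 2 ^ m * (1 + - \<alpha> / 2) ^ n" by simp
  also have "\<dots> \<le> 2 ^ m * exp (- \<alpha> / 2) ^ n"
    using \<alpha> exp_ge_add_one_self[of "- \<alpha> / 2"] by (intro mult_left_mono power_mono) auto
  \<comment> \<open>Here \<open>\<alpha> * n = 4 * m\<close>, so the total exponent is -2m.\<close>
  also have "exp (- \<alpha> / 2) ^ n = exp (- 2) ^ m"
    using n_pos by (simp add: exp_of_nat_mult[symmetric] \<alpha>_def)
  also have "2 ^ m * exp (- 2) ^ m = (2 * exp (- 2 :: real)) ^ m"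
    by (simp add: power_mult_distrib)
  also have "\<dots> \<le> (1 / 2) ^ m"
  proof (intro power_mono)
    have "(2::real) ^ 2 \<le> exp 1 ^ 2" using exp_ge_add_one_self[of "1::real"] by (intro power_mono) auto
    then have "4 \<le> exp (2::real)" by (simp add: exp_of_nat_mult[symmetric])
    then show "2 * exp (- 2 :: real) \<le> 1 / 2" by (simp add: exp_minus field_simps)
  qed simp
  also have "\<dots> \<le> (1 / 2) ^ 4" using m4 by (intro power_decreasing) auto
  finally show ?thesis by (simp add: power4_eq_xxxx)
qed

section \<open>Bounding the \<chi>^2-divergence of a single sample\<close>

text \<open>Let d be \<open>mix \<Delta> x - mix 0 x\<close>. Since the square of
  \<open>mix \<Delta> x\<close> is \<open>2 * mix \<Delta> x * mix 0 x\<close> minus the square of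
  \<open>mix 0 x\<close> plus d^2, it suffices to bound d^2 by \<open>?u * mix 0 x\<close>. The two
  components of d are separated by (s + t)^2 \<le> 2 s^2 + 2 t^2, and
  \<open>\<alpha> \<le> 1 / 2\<close> allows the factor \<open>1 - \<alpha>\<close> of the wide
  component to be pulled out.\<close>

lemma mix_sq_le: "(mix \<Delta> x)\<^sup>2 \<le> envelope x * mix 0 x"
proof -
  let ?N = "normal_density 0 R x"
  define A where "A = normal_density \<Delta> 1 x - normal_density 0 1 x"
  define B where "B = normal_density \<Delta> R x - ?N"
  have N: "0 < ?N" using R by (intro normal_density_pos) auto
  let ?u = "4 * \<alpha>\<^sup>2 * (A\<^sup>2 / ?N) + 2 * (B\<^sup>2 / ?N)"
  have d: "mix \<Delta> x - mix 0 x = \<alpha> * A + (1 - \<alpha>) * B"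
    by (simp add: mix_def A_def B_def algebra_simps)
  have "(mix \<Delta> x - mix 0 x)\<^sup>2 \<le> 2 * (\<alpha> * A)\<^sup>2 + 2 * ((1 - \<alpha>) * B)\<^sup>2"
    unfolding d using zero_le_power2[of "\<alpha> * A - (1 - \<alpha>) * B"] unfolding power2_sum power2_diff by linarith
  also have "\<dots> \<le> (1 - \<alpha>) * (4 * \<alpha>\<^sup>2 * A\<^sup>2 + 2 * B\<^sup>2)"
  proof -
    have "1 * (\<alpha>\<^sup>2 * A\<^sup>2) \<le> (2 * (1 - \<alpha>)) * (\<alpha>\<^sup>2 * A\<^sup>2)"
      using \<alpha> by (intro mult_right_mono) auto
    moreover have "(1 - \<alpha>)\<^sup>2 * B\<^sup>2 \<le> (1 - \<alpha>) * B\<^sup>2"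
      using \<alpha> by (intro mult_right_mono) (auto simp: power2_eq_square mult_left_le)
    moreover have "(1 - \<alpha>) * (4 * \<alpha>\<^sup>2 * A\<^sup>2 + 2 * B\<^sup>2) =
        2 * ((2 * (1 - \<alpha>)) * (\<alpha>\<^sup>2 * A\<^sup>2)) + 2 * ((1 - \<alpha>) * B\<^sup>2)"
      by (simp add: algebra_simps)
    ultimately show ?thesis unfolding power_mult_distrib by linarith
  qed
  also have "\<dots> = ?u * ((1 - \<alpha>) * ?N)" using N by (simp add: field_simps)
  also have "\<dots> \<le> ?u * mix 0 x"
  proof (intro mult_left_mono)
    show "(1 - \<alpha>) * ?N \<le> mix 0 x" using \<alpha> by (simp add: mix_def)
    show "0 \<le> ?u" using N by (intro add_nonneg_nonneg mult_nonneg_nonneg) auto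
  qed
  finally have "(mix \<Delta> x - mix 0 x)\<^sup>2 \<le> ?u * mix 0 x" .
  then show ?thesis
    by (simp add: envelope_def A_def[symmetric] B_def[symmetric] power2_eq_square algebra_simps)
qed


lemma envelope_nonneg: "0 \<le> envelope x"
  using mix_sq_le[of x] mix_pos[of 0 x] by (metis zero_le_mult_iff zero_le_power2 order_trans less_le_not_le mult.commute)

lemma integrable_mix: "integrable lborel (mix \<mu>)"
  unfolding mix_def[abs_def] using R by auto

lemma integral_mix: "integral\<^sup>L lborel (mix \<mu>) = 1"
  unfolding mix_def[abs_def] using R by simp

text \<open>\<open>v1\<close> is the standard deviation obtained by completing the square in \<open>normal_density_mult_div\<close>
  for \<open>\<tau> = 1\<close>.\<close>
definition v1 :: real where
  "v1 = sqrt (R\<^sup>2 / (2 * R\<^sup>2 - 1))"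

text \<open>The second fact is the hypothesis \<open>eq\<close> for \<open>\<tau> = 1\<close>. The
  last one keeps the positive exponent in the closed form below \<Delta>^2 / R^2.\<close>

lemma v1: "0 < v1" "1 / v1\<^sup>2 = 2 / 1\<^sup>2 - 1 / R\<^sup>2" "v1 \<le> 1" "2 * v1\<^sup>2 - 1 \<le> 1 / R\<^sup>2"
proof -
  have R2: "1 \<le> R\<^sup>2" using R by (simp add: one_le_power)
  have v2: "v1\<^sup>2 = R\<^sup>2 / (2 * R\<^sup>2 - 1)" using R2 by (simp add: v1_def)
  have "0 < R\<^sup>2 / (2 * R\<^sup>2 - 1)" using R2 by (intro divide_pos_pos) linarith+
  then show "0 < v1" by (simp add: v1_def)
  show "1 / v1\<^sup>2 = 2 / 1\<^sup>2 - 1 / R\<^sup>2" using R R2 by (simp add: v2 field_simps)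
  show "v1 \<le> 1" using R2 by (simp add: v1_def)
  have "2 * v1\<^sup>2 - 1 = 1 / (2 * R\<^sup>2 - 1)" using R2 by (simp add: v2 field_simps)
  also have "\<dots> \<le> 1 / R\<^sup>2" using R2 by (intro divide_left_mono mult_pos_pos) auto
  finally show "2 * v1\<^sup>2 - 1 \<le> 1 / R\<^sup>2" .
qed

text \<open>The hypothesis \<open>eq\<close> for \<open>\<tau> = v = R\<close>.\<close>

lemma R_scale: "1 / R\<^sup>2 = 2 / R\<^sup>2 - 1 / R\<^sup>2"
  by simp

lemma R_pos: "0 < R" using R by simp

lemma integrable_envelope: "integrable lborel envelope"
  unfolding envelope_def[abs_def]
  by (intro Bochner_Integration.integrable_add Bochner_Integration.integrable_diff integrable_mult_right
      integrable_mix integrable_normal_density_diff_sq[OF zero_less_one R_pos v1(1,2)]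
      integrable_normal_density_diff_sq[OF R_pos R_pos R_pos R_scale])

lemma integral_envelope_le: "integral\<^sup>L lborel envelope \<le> 1 + 1 / (16 * real n)"
proof -
  let ?S1 = "\<lambda>x. (normal_density \<Delta> 1 x - normal_density 0 1 x)\<^sup>2 / normal_density 0 R x"
  let ?S2 = "\<lambda>x. (normal_density \<Delta> R x - normal_density 0 R x)\<^sup>2 / normal_density 0 R x"
  note i1 = integrable_normal_density_diff_sq[OF zero_less_one R_pos v1(1,2), of \<Delta>]
  note i2 = integrable_normal_density_diff_sq[OF R_pos R_pos R_pos R_scale, of \<Delta>]
  have eq: "integral\<^sup>L lborel envelope =
      1 + 4 * \<alpha>\<^sup>2 * integral\<^sup>L lborel ?S1 + 2 * integral\<^sup>L lborel ?S2"
  proof -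
    have "has_bochner_integral lborel envelope
       (2 * 1 - 1 + 4 * \<alpha>\<^sup>2 * integral\<^sup>L lborel ?S1 + 2 * integral\<^sup>L lborel ?S2)"
      unfolding envelope_def[abs_def]
      using has_bochner_integral_integrable[OF integrable_mix] i1 i2
      by (intro has_bochner_integral_add has_bochner_integral_diff has_bochner_integral_mult_right
          has_bochner_integral_integrable) (simp_all add: integral_mix)
    then show ?thesis by (simp add: has_bochner_integral_integral_eq)
  qed
  have y: "0 \<le> \<Delta>\<^sup>2 / R\<^sup>2" "\<Delta>\<^sup>2 / R\<^sup>2 \<le> 1"
    using \<Delta>R \<Delta>0 R_pos by (auto simp: power_mono)
  have e: "exp (\<Delta>\<^sup>2 / R\<^sup>2) \<le> 1 + 2 * \<Delta>\<^sup>2 / R\<^sup>2"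
    using exp_le_one_plus_double[OF y] by simp
  \<comment> \<open>For \<open>\<tau> = v = R\<close> the closed form collapses to exp (\<Delta>^2 /
    R^2) - 1.\<close>
  have S2: "integral\<^sup>L lborel ?S2 \<le> 2 * \<Delta>\<^sup>2 / R\<^sup>2"
  proof -
    have "\<Delta>\<^sup>2 * (2 * R\<^sup>2 - R\<^sup>2) / R^4 = \<Delta>\<^sup>2 / R\<^sup>2" using R_pos by (simp add: field_simps power2_eq_square power4_eq_xxxx)
    then show ?thesis
      unfolding integral_normal_density_diff_sq[OF R_pos R_pos R_pos R_scale]
      using R_pos e by (simp add: power2_eq_square)
  qed
  have S1: "integral\<^sup>L lborel ?S1 \<le> R * (2 * \<Delta>\<^sup>2 / R\<^sup>2 + min 2 (\<Delta>\<^sup>2))"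
  proof -
    have "\<Delta>\<^sup>2 * (2 * v1\<^sup>2 - 1\<^sup>2) / 1^4 \<le> \<Delta>\<^sup>2 / R\<^sup>2"
      using mult_left_mono[OF v1(4), of "\<Delta>\<^sup>2"] by simp
    then have "exp (\<Delta>\<^sup>2 * (2 * v1\<^sup>2 - 1\<^sup>2) / 1^4) \<le> 1 + 2 * \<Delta>\<^sup>2 / R\<^sup>2"
      using e by (meson exp_le_cancel_iff order_trans)
    \<comment> \<open>The difference on the left is also below 1. Twice the smaller of the two
      bounds is the \<open>min\<close> in \<open>S1\<close>: \<Delta>^2 for small shifts, 2 once the
      narrow components are well separated.\<close>
    moreover have "1 - exp (- \<Delta>\<^sup>2 * (1\<^sup>2 - v1\<^sup>2) / (2 * 1^4)) \<le> \<Delta>\<^sup>2 / 2"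
    proof -
      have "1 + (- \<Delta>\<^sup>2 * (1\<^sup>2 - v1\<^sup>2) / (2 * 1^4)) \<le> exp (- \<Delta>\<^sup>2 * (1\<^sup>2 - v1\<^sup>2) / (2 * 1^4))"
        by (rule exp_ge_add_one_self)
      moreover have "\<Delta>\<^sup>2 * (1\<^sup>2 - v1\<^sup>2) \<le> \<Delta>\<^sup>2" by (simp add: mult_left_le)
      ultimately show ?thesis by simp
    qed
    moreover have "0 < exp (- \<Delta>\<^sup>2 * (1\<^sup>2 - v1\<^sup>2) / (2 * 1^4))" by simp
    ultimately have "exp (\<Delta>\<^sup>2 * (2 * v1\<^sup>2 - 1\<^sup>2) / 1^4) + 1 - 2 * exp (- \<Delta>\<^sup>2 * (1\<^sup>2 - v1\<^sup>2) / (2 * 1^4))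
        \<le> 2 * \<Delta>\<^sup>2 / R\<^sup>2 + min 2 (\<Delta>\<^sup>2)" by linarith
    then have "R * v1 / 1\<^sup>2 * (exp (\<Delta>\<^sup>2 * (2 * v1\<^sup>2 - 1\<^sup>2) / 1^4) + 1 - 2 * exp (- \<Delta>\<^sup>2 * (1\<^sup>2 - v1\<^sup>2) / (2 * 1^4)))
        \<le> R * v1 / 1\<^sup>2 * (2 * \<Delta>\<^sup>2 / R\<^sup>2 + min 2 (\<Delta>\<^sup>2))"
      using R_pos v1 by (intro mult_left_mono) auto
    also have "\<dots> \<le> R * (2 * \<Delta>\<^sup>2 / R\<^sup>2 + min 2 (\<Delta>\<^sup>2))"
      using R_pos v1 by (intro mult_right_mono) (auto simp: mult_left_le)
    finally show ?thesis
      unfolding integral_normal_density_diff_sq[OF zero_less_one R_pos v1(1,2)] .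
  qed
  have "4 * \<alpha>\<^sup>2 * integral\<^sup>L lborel ?S1 \<le> 4 * \<alpha>\<^sup>2 * (R * (2 * \<Delta>\<^sup>2 / R\<^sup>2 + min 2 (\<Delta>\<^sup>2)))"
    by (intro mult_left_mono S1) auto
  then show ?thesis using eq S2 chi[folded \<alpha>_def] by (simp add: mult.assoc)
qed

section \<open>Integration over all samples and overlap of the two laws\<close>

lemmas integrable_prodM = product_sigma_finite.product_integrable_prod
  [OF product_sigma_finite_lborel finite_atLeastAtMost]

lemmas integral_prodM = product_sigma_finite.product_integral_prod
  [OF product_sigma_finite_lborel finite_atLeastAtMost]

lemma has_integral_lik:
  "\<sigma> \<in> configs \<Longrightarrow> has_bochner_integral prodM (lik \<mu> \<sigma>) 1"
  using configs_pos unfolding lik_def[abs_def] has_bochner_integral_iff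
  by (subst integral_prodM) (auto intro!: integrable_prodM)

lemma has_integral_prod_mix:
  "has_bochner_integral prodM (\<lambda>x. \<Prod>i\<in>{1..n}. mix \<mu> (x i)) 1"
  unfolding has_bochner_integral_iff
  by (subst integral_prodM) (auto simp: integrable_mix integral_mix intro!: integrable_prodM)

lemma has_integral_prod_envelope:
  "has_bochner_integral prodM (\<lambda>x. \<Prod>i\<in>{1..n}. envelope (x i)) (integral\<^sup>L lborel envelope ^ n)"
  unfolding has_bochner_integral_iff
  by (subst integral_prodM) (auto simp: integrable_envelope intro!: integrable_prodM)

text \<open>The integral of (mix \<Delta>)^2 / mix 0 is multiplicative over independent samples, so
  a divergence of \<open>1 / (16 * real n)\<close> per sample costs only a constant factor in
  total.\<close>

lemma integral_envelope_power_le: "integral\<^sup>L lborel envelope ^ n \<le> 9 / 8"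
proof -
  have "integral\<^sup>L lborel envelope ^ n \<le> (1 + 1 / (16 * real n)) ^ n"
    by (intro power_mono integral_envelope_le integral_nonneg_AE) (auto simp: envelope_nonneg)
  also have "\<dots> \<le> exp (1 / (16 * real n)) ^ n"
    by (intro power_mono exp_ge_add_one_self) auto
  also have "\<dots> = exp (1 / 16)" using n_pos by (simp add: exp_of_nat_mult[symmetric])
  also have "\<dots> \<le> 9 / 8" using exp_le_one_plus_double[of "1/16"] by simp
  finally show ?thesis .
qed

text \<open>The joint density under the conditioned prior, left without the factor
  \<open>1 / sum weight good\<close> so that \<open>good_lik\<close> and \<open>bad_lik\<close> add
  up to the product of the mixture densities.\<close>

definition good_lik :: "real \<Rightarrow> (nat \<Rightarrow> real) \<Rightarrow> real" where
  "good_lik \<mu> x = (\<Sum>\<sigma>\<in>good. weight \<sigma> * lik \<mu> \<sigma> x)"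

definition bad_lik :: "real \<Rightarrow> (nat \<Rightarrow> real) \<Rightarrow> real" where
  "bad_lik \<mu> x = (\<Sum>\<sigma>\<in>configs - good. weight \<sigma> * lik \<mu> \<sigma> x)"

text \<open>A lower bound for \<open>min (good_lik 0) (good_lik \<Delta>)\<close>, obtained from \<open>min_ge_of_sq_le\<close>, that can be
  integrated term by term.\<close>
definition overlap :: "(nat \<Rightarrow> real) \<Rightarrow> real" where
  "overlap x = 2 * (\<Prod>i\<in>{1..n}. mix \<Delta> (x i)) - (\<Prod>i\<in>{1..n}. envelope (x i))
    - (\<Prod>i\<in>{1..n}. mix 0 (x i)) / 4 - bad_lik 0 x - bad_lik \<Delta> x"

text \<open>The two-point argument: \<Delta> \<le> \<bar>e\<bar> + \<bar>e - \<Delta>\<bar>, so any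
  guess \<open>e\<close> pays at least \<Delta> times the smaller density. Subtracting both bad
  parts converts the bound for the full mixtures into one for the good parts.\<close>

lemma overlap_le: "\<Delta> * overlap x \<le> \<bar>e\<bar> * good_lik 0 x + \<bar>e - \<Delta>\<bar> * good_lik \<Delta> x"
proof -
  let ?P = "\<lambda>\<mu>. \<Prod>i\<in>{1..n}. mix \<mu> (x i)"
  have "(?P \<Delta>)\<^sup>2 = (\<Prod>i\<in>{1..n}. (mix \<Delta> (x i))\<^sup>2)" by (simp add: prod_power_distrib)
  also have "\<dots> \<le> (\<Prod>i\<in>{1..n}. envelope (x i) * mix 0 (x i))"
    by (intro prod_mono conjI mix_sq_le) auto
  finally have sq: "(?P \<Delta>)\<^sup>2 \<le> (\<Prod>i\<in>{1..n}. envelope (x i)) * ?P 0"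
    by (simp add: prod.distrib)
  have "0 < ?P 0" by (intro prod_pos mix_pos)
  note m = min_ge_of_sq_le[OF this sq]
  have split: "?P \<mu> = good_lik \<mu> x + bad_lik \<mu> x" for \<mu>
    unfolding prod_mix good_lik_def bad_lik_def
    using sum.subset_diff[OF good_subset finite_configs, of "\<lambda>\<sigma>. weight \<sigma> * lik \<mu> \<sigma> x"] by simp
  have bad: "0 \<le> bad_lik \<mu> x" for \<mu>
    unfolding bad_lik_def by (intro sum_nonneg mult_nonneg_nonneg lik_nonneg less_imp_le[OF weight_pos])
  have good: "0 \<le> good_lik \<mu> x" for \<mu>
    unfolding good_lik_def by (intro sum_nonneg mult_nonneg_nonneg lik_nonneg less_imp_le[OF weight_pos])
  have "overlap x \<le> min (good_lik 0 x) (good_lik \<Delta> x)"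
    using m bad[of 0] bad[of \<Delta>] unfolding overlap_def split by linarith
  then have "\<Delta> * overlap x \<le> \<Delta> * min (good_lik 0 x) (good_lik \<Delta> x)"
    using \<Delta>0 by (intro mult_left_mono) auto
  also have "\<dots> \<le> (\<bar>e\<bar> + \<bar>e - \<Delta>\<bar>) * min (good_lik 0 x) (good_lik \<Delta> x)"
    using good by (intro mult_right_mono) auto
  also have "\<dots> \<le> \<bar>e\<bar> * good_lik 0 x + \<bar>e - \<Delta>\<bar> * good_lik \<Delta> x"
    unfolding distrib_right by (intro add_mono mult_left_mono) auto
  finally show ?thesis .
qed

lemma has_integral_overlap:
  obtains I where "1 / 2 \<le> I" "has_bochner_integral prodM overlap I"
proof
  let ?b = "\<Sum>\<sigma>\<in>configs - good. weight \<sigma> * 1"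
  have "has_bochner_integral prodM (bad_lik \<mu>) ?b" for \<mu>
    unfolding bad_lik_def[abs_def]
    by (intro has_bochner_integral_sum has_bochner_integral_mult_right has_integral_lik) auto
  then show "has_bochner_integral prodM overlap
      (2 * 1 - integral\<^sup>L lborel envelope ^ n - 1 / 4 - ?b - ?b)"
    unfolding overlap_def[abs_def]
    by (intro has_bochner_integral_diff has_bochner_integral_mult_right has_bochner_integral_divide_zero
        has_integral_prod_mix has_integral_prod_envelope)
  \<comment> \<open>With the bounds 9/8 and 1/16 this is 2 - 9/8 - 1/4 - 1/16 - 1/16 = 1/2.\<close>
  show "1 / 2 \<le> 2 * 1 - integral\<^sup>L lborel envelope ^ n - 1 / 4 - ?b - ?b"
    using weight_bad integral_envelope_power_le by simp
qed

lemma weight_good: "0 < sum weight good" "sum weight good \<le> 1"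
  using sum.subset_diff[OF good_subset finite_configs, of weight] weight_bad sum_weight
    sum_nonneg[of "configs - good" weight] weight_pos
  by (auto simp: less_imp_le)

section \<open>The prior as a distribution on instances\<close>

definition family :: "(real \<times> (nat \<Rightarrow> real)) set" where
  "family = {0, \<Delta>} \<times> good"

text \<open>The factor 2 splits the mass evenly between the two means; dividing by
  \<open>sum weight good\<close> is the conditioning on \<open>good\<close>.\<close>

definition prior :: "(real \<times> (nat \<Rightarrow> real)) measure" where
  "prior = point_measure family (\<lambda>(\<mu>, \<sigma>). ennreal (weight \<sigma> / (2 * sum weight good)))"

lemma finite_family: "finite family"
  by (simp add: family_def)

lemma family_subset: "family \<subseteq> instances n"
proof -
  have "\<sigma> \<in> configs" if "\<sigma> \<in> good" for \<sigma> using that good_subset by blast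
  then show ?thesis
    using configs_pos
    by (fastforce simp: family_def instances_def instance_space_def space_pair_measure space_PiM configs_def)
qed

lemma order_stat_family: "(\<mu>, \<sigma>) \<in> family \<Longrightarrow> order_stat n \<sigma> m \<le> 1"
proof (rule order_stat_le)
  assume "(\<mu>, \<sigma>) \<in> family"
  then have "m \<le> card {i \<in> {1..n}. \<sigma> i = 1}" by (simp add: family_def good_def)
  also have "\<dots> \<le> card {i \<in> {1..n}. \<sigma> i \<le> 1}" by (intro card_mono) auto
  finally show "m \<le> card {i \<in> {1..n}. \<sigma> i \<le> 1}" .
qed (use m4 in simp)

text \<open>Standard deviations are extensional on \<open>{1..n}\<close>, so a single instance is a
  box with singleton sides and therefore measurable.\<close>

lemma sets_finite_instance:
  assumes "finite A" "A \<subseteq> space (instance_space n)" shows "A \<in> sets (instance_space n)"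
proof (rule sets.countable[OF _ countable_finite[OF assms(1)]])
  fix a assume "a \<in> A"
  obtain \<mu> \<sigma> where a: "a = (\<mu>, \<sigma>)" by fastforce
  have "\<sigma> \<in> extensional {1..n}"
    using \<open>a \<in> A\<close> assms(2) by (auto simp: a instance_space_def space_pair_measure space_PiM PiE_def)
  then have "{a} = {\<mu>} \<times> Pi\<^sub>E {1..n} (\<lambda>i. {\<sigma> i})"
    unfolding a by (simp add: PiE_singleton)
  also have "\<dots> \<in> sets (instance_space n)"
    unfolding instance_space_def by (intro pair_measureI sets_PiM_I_finite) auto
  finally show "{a} \<in> sets (instance_space n)" .
qed

lemma distribution_on_prior: "distribution_on n family prior"
  unfolding distribution_on_def
proof (intro conjI)
  show "space prior = family" by (simp add: prior_def space_point_measure)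
  have sub: "family \<subseteq> space (instance_space n)" using family_subset by (auto simp: instances_def)
  \<comment> \<open>The family is finite, so its trace is the full power set, which is also the
    sigma-algebra of \<open>point_measure\<close>.\<close>
  have "sets (restrict_space (instance_space n) family) = Pow family"
  proof
    show "sets (restrict_space (instance_space n) family) \<subseteq> Pow family"
      by (auto simp: sets_restrict_space)
    show "Pow family \<subseteq> sets (restrict_space (instance_space n) family)"
    proof
      fix A assume "A \<in> Pow family"
      then have "A \<in> sets (instance_space n)" "A = family \<inter> A"
        using sub finite_family by (auto intro!: sets_finite_instance dest: finite_subset)
      then show "A \<in> sets (restrict_space (instance_space n) family)"
        unfolding sets_restrict_space by (metis image_eqI)
    qed
  qed
  then show "sets prior = sets (restrict_space (instance_space n) family)"
    by (simp add: prior_def sets_point_measure)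
  have "emeasure prior (space prior) = (\<Sum>(\<mu>, \<sigma>)\<in>family. ennreal (weight \<sigma> / (2 * sum weight good)))"
    unfolding prior_def space_point_measure
    by (subst emeasure_point_measure_finite[OF finite_family]) auto
  also have "\<dots> = ennreal (\<Sum>(\<mu>, \<sigma>)\<in>family. weight \<sigma> / (2 * sum weight good))"
    using weight_good weight_pos
    by (subst sum_ennreal[symmetric]) (auto intro!: sum.cong simp: less_imp_le)
  also have "(\<Sum>(\<mu>, \<sigma>)\<in>family. weight \<sigma> / (2 * sum weight good)) = 1"
    using weight_good \<Delta>0 unfolding family_def sum.cartesian_product[symmetric]
    by (simp add: sum_divide_distrib[symmetric])
  finally show "prob_space prior" by (intro prob_spaceI) simp
qed

section \<open>Lower bound on the expected error\<close>

text \<open>Written over the common reference measure \<open>prodM\<close>, the expected error has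
  an integrand that \<open>overlap_le\<close> bounds below by
  \<open>\<Delta> / 2 * overlap x\<close> wherever \<open>overlap x\<close> is nonnegative. The
  overlap has integral at least 1/2.\<close>

lemma expected_error_ge:
  assumes est: "estimator n est"
  shows "ennreal (\<Delta> / 4) \<le> expected_error n prior est"
proof -
  let ?Z = "sum weight good"
  have est' [measurable]: "est \<in> borel_measurable prodM"
    using est by (simp cong: measurable_cong_sets sets_PiM_cong)
  have lik [measurable]: "lik \<mu> \<sigma> \<in> borel_measurable prodM" for \<mu> \<sigma>
    unfolding lik_def[abs_def] by measurable
  have sample: "ennreal (weight \<sigma> / (2 * ?Z)) * (\<integral>\<^sup>+ x. ennreal \<bar>est x - \<mu>\<bar> \<partial>sample_measure n \<mu> \<sigma>) =
      (\<integral>\<^sup>+ x. ennreal (weight \<sigma> / (2 * ?Z) * (lik \<mu> \<sigma> x * \<bar>est x - \<mu>\<bar>)) \<partial>prodM)" if "\<sigma> \<in> good" for \<mu> \<sigma>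
  proof -
    have pos: "\<And>i. i \<in> {1..n} \<Longrightarrow> 0 < \<sigma> i" using that good_subset configs_pos by blast
    have "sample_measure n \<mu> \<sigma> = density prodM (\<lambda>x. ennreal (lik \<mu> \<sigma> x))"
      unfolding lik_def by (rule sample_measure_eq_density[OF pos])
    then have e: "(\<integral>\<^sup>+ x. ennreal \<bar>est x - \<mu>\<bar> \<partial>sample_measure n \<mu> \<sigma>) =
        (\<integral>\<^sup>+ x. ennreal (lik \<mu> \<sigma> x) * ennreal \<bar>est x - \<mu>\<bar> \<partial>prodM)"
      by (simp only:) (rule nn_integral_density; measurable)
    show ?thesis
      unfolding e using weight_good weight_pos[of \<sigma>] lik_nonneg
      by (subst nn_integral_cmult[symmetric], measurable)
        (auto simp: ennreal_mult[symmetric] less_imp_le intro!: nn_integral_cong)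
  qed
  obtain I where I: "1 / 2 \<le> I" "has_bochner_integral prodM overlap I" by (rule has_integral_overlap)
  have "expected_error n prior est =
      (\<Sum>(\<mu>, \<sigma>)\<in>family. ennreal (weight \<sigma> / (2 * ?Z)) * (\<integral>\<^sup>+ x. ennreal \<bar>est x - \<mu>\<bar> \<partial>sample_measure n \<mu> \<sigma>))"
    unfolding expected_error_def prior_def
    by (subst nn_integral_point_measure_finite[OF finite_family]) (auto intro!: sum.cong)
  also have "\<dots> = (\<Sum>(\<mu>, \<sigma>)\<in>family. \<integral>\<^sup>+ x. ennreal (weight \<sigma> / (2 * ?Z) * (lik \<mu> \<sigma> x * \<bar>est x - \<mu>\<bar>)) \<partial>prodM)"
    by (intro sum.cong refl) (simp only: split_paired_all prod.case, rule sample, auto simp: family_def)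
  also have "\<dots> = (\<integral>\<^sup>+ x. (\<Sum>(\<mu>, \<sigma>)\<in>family. ennreal (weight \<sigma> / (2 * ?Z) * (lik \<mu> \<sigma> x * \<bar>est x - \<mu>\<bar>))) \<partial>prodM)"
    unfolding case_prod_beta by (rule nn_integral_sum[symmetric]) measurable
  also have "\<dots> = (\<integral>\<^sup>+ x. ennreal ((\<bar>est x\<bar> * good_lik 0 x + \<bar>est x - \<Delta>\<bar> * good_lik \<Delta> x) / (2 * ?Z)) \<partial>prodM)"
  proof (intro nn_integral_cong)
    fix x
    have "(\<Sum>(\<mu>, \<sigma>)\<in>family. ennreal (weight \<sigma> / (2 * ?Z) * (lik \<mu> \<sigma> x * \<bar>est x - \<mu>\<bar>))) =
      ennreal (\<Sum>(\<mu>, \<sigma>)\<in>family. weight \<sigma> / (2 * ?Z) * (lik \<mu> \<sigma> x * \<bar>est x - \<mu>\<bar>))"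
      using weight_good weight_pos lik_nonneg
      by (subst sum_ennreal[symmetric]) (auto intro!: sum.cong simp: less_imp_le)
    also have "(\<Sum>(\<mu>, \<sigma>)\<in>family. weight \<sigma> / (2 * ?Z) * (lik \<mu> \<sigma> x * \<bar>est x - \<mu>\<bar>)) =
      (\<bar>est x\<bar> * good_lik 0 x + \<bar>est x - \<Delta>\<bar> * good_lik \<Delta> x) / (2 * ?Z)"
      using \<Delta>0 unfolding family_def sum.cartesian_product[symmetric] good_lik_def
      by (simp add: sum_distrib_left add_divide_distrib sum_divide_distrib mult_ac)
    finally show "(\<Sum>(\<mu>, \<sigma>)\<in>family. ennreal (weight \<sigma> / (2 * ?Z) * (lik \<mu> \<sigma> x * \<bar>est x - \<mu>\<bar>))) =
      ennreal ((\<bar>est x\<bar> * good_lik 0 x + \<bar>est x - \<Delta>\<bar> * good_lik \<Delta> x) / (2 * ?Z))" .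
  qed
  finally have err: "expected_error n prior est = (\<integral>\<^sup>+ x. ennreal ((\<bar>est x\<bar> * good_lik 0 x
      + \<bar>est x - \<Delta>\<bar> * good_lik \<Delta> x) / (2 * ?Z)) \<partial>prodM)" .
  have "ennreal (\<Delta> / 4) \<le> ennreal (\<Delta> / 2 * I)"
    using mult_left_mono[OF I(1), of "\<Delta> / 2"] \<Delta>0 by (intro ennreal_leI) simp
  also have "\<Delta> / 2 * I = (\<integral> x. \<Delta> / 2 * overlap x \<partial>prodM)"
    using I(2) by (simp add: has_bochner_integral_iff)
  \<comment> \<open>\<open>overlap\<close> may be negative, so its positive part is taken before
    passing to the nonnegative integral.\<close>
  also have "ennreal \<dots> \<le> ennreal (\<integral> x. \<Delta> / 2 * max 0 (overlap x) \<partial>prodM)"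
    using I(2) \<Delta>0 by (intro ennreal_leI integral_mono) (auto simp: has_bochner_integral_iff)
  also have "\<dots> = (\<integral>\<^sup>+ x. ennreal (\<Delta> / 2 * max 0 (overlap x)) \<partial>prodM)"
    using I(2) \<Delta>0 by (intro nn_integral_eq_integral[symmetric]) (auto simp: has_bochner_integral_iff)
  also have "\<dots> \<le> expected_error n prior est"
    unfolding err
  proof (intro nn_integral_mono ennreal_leI)
    fix x
    let ?L = "\<bar>est x\<bar> * good_lik 0 x + \<bar>est x - \<Delta>\<bar> * good_lik \<Delta> x"
    have L0: "0 \<le> ?L"
      unfolding good_lik_def by (intro add_nonneg_nonneg mult_nonneg_nonneg sum_nonneg lik_nonneg
          less_imp_le[OF weight_pos]) auto
    have "\<Delta> / 2 * max 0 (overlap x) = max 0 (\<Delta> * overlap x) / 2"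
      using \<Delta>0 by (auto simp: max_def zero_le_mult_iff)
    also have "\<dots> \<le> ?L / 2" using L0 overlap_le[of x "est x"] by simp
    \<comment> \<open>Conditioning can only enlarge the integrand, because
      \<open>?Z \<le> 1\<close>.\<close>
    also have "\<dots> \<le> ?L / (2 * ?Z)" using L0 weight_good by (intro divide_left_mono) auto
    finally show "\<Delta> / 2 * max 0 (overlap x) \<le> ?L / (2 * ?Z)" .
  qed
  finally show ?thesis .
qed

end

section \<open>Choice of the scales in the two regimes\<close>

text \<open>With \<Delta> = R / (64 \<surd>n) the wide component uses 1 / (1024 n) of the budget 1 /
  (16 n) in \<open>chi\<close>. What is left is \<open>spike\<close>, a condition on the narrow
  component; the bound on \<open>L\<close> is \<Delta> / 4.\<close>

lemma two_scale_lower_bound: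
  fixes n m :: nat and R L :: real
  assumes m4: "4 \<le> m" and mn: "8 * m \<le> n" and R: "1 < R"
    and spike: "(4 * real m / real n)\<^sup>2 * R * (1 / (2048 * real n) + min 2 (R\<^sup>2 / (4096 * real n))) \<le> 1 / (80 * real n)"
    and L: "L \<le> R / (256 * sqrt n)"
  shows "\<exists>F D. F \<subseteq> instances n \<and> (\<forall>(\<mu>, \<sigma>) \<in> F. order_stat n \<sigma> m \<le> 1) \<and> distribution_on n F D \<and>
    (\<forall>est. estimator n est \<longrightarrow> expected_error n D est \<ge> ennreal L)"
proof -
  have n: "1 \<le> real n" using m4 mn by simp
  define \<Delta> where "\<Delta> = R / (64 * sqrt n)"
  have \<Delta>2: "\<Delta>\<^sup>2 = R\<^sup>2 / (4096 * real n)" by (simp add: \<Delta>_def power_divide power_mult_distrib)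
  interpret two_scale_prior n m R \<Delta>
  proof
    show "0 < \<Delta>" using R n by (simp add: \<Delta>_def)
    have "1 * 1 \<le> 64 * sqrt n" using n by (intro mult_mono) auto
    then show "\<Delta> \<le> R" using R n by (simp add: \<Delta>_def divide_le_eq mult_left_mono)
    have "4 * (4 * real m / real n)\<^sup>2 * R * (2 * \<Delta>\<^sup>2 / R\<^sup>2 + min 2 (\<Delta>\<^sup>2)) + 4 * \<Delta>\<^sup>2 / R\<^sup>2 =
      4 * ((4 * real m / real n)\<^sup>2 * R * (1 / (2048 * real n) + min 2 (R\<^sup>2 / (4096 * real n)))) + 1 / (1024 * real n)"
      using R by (simp add: \<Delta>2)
    also have "\<dots> \<le> 4 * (1 / (80 * real n)) + 1 / (1024 * real n)" using spike by (intro add_right_mono mult_left_mono) auto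
    also have "\<dots> \<le> 1 / (16 * real n)" using n by (simp add: field_simps)
    finally show "4 * (4 * real m / real n)\<^sup>2 * R * (2 * \<Delta>\<^sup>2 / R\<^sup>2 + min 2 (\<Delta>\<^sup>2)) + 4 * \<Delta>\<^sup>2 / R\<^sup>2 \<le> 1 / (16 * real n)" .
  qed (use m4 mn R in auto)
  have "ennreal L \<le> ennreal (\<Delta> / 4)" using L by (intro ennreal_leI) (simp add: \<Delta>_def)
  then have "ennreal L \<le> expected_error n prior est" if "estimator n est" for est
    using expected_error_ge[OF that] by (rule order_trans)
  then show ?thesis
    using family_subset order_stat_family distribution_on_prior by blast
qed

lemma lower_bound_small_m:
  fixes n m :: nat
  assumes m4: "4 \<le> m" and mn: "8 * m \<le> n" and small: "4096 * (real m)\<^sup>2 < real n"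
  shows "\<exists>F D. F \<subseteq> instances n \<and> (\<forall>(\<mu>, \<sigma>) \<in> F. order_stat n \<sigma> m \<le> 1) \<and> distribution_on n F D \<and>
    (\<forall>est. estimator n est \<longrightarrow>
      expected_error n D est \<ge> ennreal (1 / 1048576 * (real n / real m ^ 4) powr (1/2)))"
proof (rule two_scale_lower_bound[OF m4 mn])
  \<comment> \<open>Chosen so that \<alpha>^2 R = 1 / (256 n), small enough to bound the
    \<open>min\<close> simply by 2. The assumption \<open>small\<close> says R > 1, and 1048576 =
    4096 * 256.\<close>
  define R where "R = real n / (4096 * (real m)\<^sup>2)"
  have pos: "0 < real m" "0 < real n" using m4 mn by auto
  show "1 < real n / (4096 * (real m)\<^sup>2)" using small pos by (simp add: field_simps)
  have "(4 * real m / real n)\<^sup>2 * R = 1 / (256 * real n)"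
    using pos by (simp add: R_def power2_eq_square field_simps)
  then have "(4 * real m / real n)\<^sup>2 * R * (1 / (2048 * real n) + min 2 (R\<^sup>2 / (4096 * real n)))
      \<le> 1 / (256 * real n) * (1 / 2048 + 2)"
    using pos by (simp only:) (intro mult_left_mono add_mono min.cobounded1, auto simp: field_simps)
  also have "\<dots> \<le> 1 / (80 * real n)" using pos by (simp add: field_simps)
  finally show "(4 * real m / real n)\<^sup>2 * (real n / (4096 * (real m)\<^sup>2)) *
      (1 / (2048 * real n) + min 2 ((real n / (4096 * (real m)\<^sup>2))\<^sup>2 / (4096 * real n))) \<le> 1 / (80 * real n)"
    by (simp add: R_def)
  have "real m ^ 4 = ((real m)\<^sup>2)\<^sup>2" by simp
  then have "(real n / real m ^ 4) powr (1/2) = sqrt n / (real m)\<^sup>2"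
    using pos by (simp only: powr_half_sqrt real_sqrt_divide real_sqrt_abs abs_power2
        divide_nonneg_nonneg zero_le_power2 of_nat_0_le_iff)
  also have "\<dots> = n / (real m)\<^sup>2 / sqrt n" using pos by (simp add: field_simps)
  finally show "1 / 1048576 * (real n / real m ^ 4) powr (1/2) \<le>
      real n / (4096 * (real m)\<^sup>2) / (256 * sqrt n)"
    by (simp add: field_simps)
qed

lemma lower_bound_large_m:
  fixes n m :: nat
  assumes m4: "4 \<le> m" and mn: "8 * m \<le> n"
  shows "\<exists>F D. F \<subseteq> instances n \<and> (\<forall>(\<mu>, \<sigma>) \<in> F. order_stat n \<sigma> m \<le> 1) \<and> distribution_on n F D \<and>
    (\<forall>est. estimator n est \<longrightarrow>
      expected_error n D est \<ge> ennreal (1 / 256 * (real n / real m ^ 4) powr (1/6)))"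
proof (rule two_scale_lower_bound[OF m4 mn])
  \<comment> \<open>Here R^3 = (n / m)^2, hence \<alpha>^2 R = 16 / R^2, which cancels the R^2 in
    the second argument of the \<open>min\<close>. The resulting rate R / \<surd>n is n^(1/6) /
    m^(2/3).\<close>
  define R where "R = (real n / real m) powr (2/3)"
  have pos: "0 < real m" "0 < real n" using m4 mn by auto
  have "1 < real n / real m" using pos mn by (simp add: field_simps)
  then show R1: "1 < (real n / real m) powr (2/3)" by (intro gr_one_powr) auto
  then have Rp: "0 < R" "1 \<le> R\<^sup>2" using pos by (auto simp: R_def one_le_power)
  have "R ^ 3 = (real n / real m)\<^sup>2"
    using pos by (simp add: R_def powr_power powr_numeral)
  then have "(4 * real m / real n)\<^sup>2 = 16 / R ^ 3"
    using pos by (simp add: power_divide power_mult_distrib)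
  then have q: "(4 * real m / real n)\<^sup>2 * R = 16 / R\<^sup>2"
    using Rp by (simp add: power3_eq_cube power2_eq_square)
  have "16 / R\<^sup>2 * (1 / (2048 * real n) + min 2 (R\<^sup>2 / (4096 * real n)))
      \<le> 16 / R\<^sup>2 * (1 / (2048 * real n) + R\<^sup>2 / (4096 * real n))"
    by (intro mult_left_mono add_left_mono) auto
  also have "\<dots> = 16 / R\<^sup>2 * (1 / (2048 * real n)) + 1 / (256 * real n)"
    using Rp by (simp add: distrib_left)
  also have "16 / R\<^sup>2 * (1 / (2048 * real n)) \<le> 16 * (1 / (2048 * real n))"
    using Rp by (intro mult_right_mono) (auto simp: divide_le_eq)
  also have "16 * (1 / (2048 * real n)) + 1 / (256 * real n) \<le> 1 / (80 * real n)"
    using pos by (simp add: field_simps)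
  finally have "16 / R\<^sup>2 * (1 / (2048 * real n) + min 2 (R\<^sup>2 / (4096 * real n))) \<le> 1 / (80 * real n)" by simp
  then show "(4 * real m / real n)\<^sup>2 * ((real n / real m) powr (2/3)) *
      (1 / (2048 * real n) + min 2 (((real n / real m) powr (2/3))\<^sup>2 / (4096 * real n))) \<le> 1 / (80 * real n)"
    using q by (simp only: R_def)
  have "(real n / real m ^ 4) powr (1/6) = exp ((ln n - 4 * ln m) / 6)"
    using pos by (simp add: powr_def ln_div ln_realpow)
  also have "\<dots> = exp (2 / 3 * (ln n - ln m) - ln n / 2)"
    by (rule arg_cong[where f = exp]) (simp add: field_simps)
  also have "\<dots> = R / sqrt n"
    using pos by (simp add: R_def exp_diff powr_def ln_div powr_half_sqrt[symmetric])
  finally show "1 / 256 * (real n / real m ^ 4) powr (1/6) \<le>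
      (real n / real m) powr (2/3) / (256 * sqrt n)"
    by (simp add: R_def)
qed

theorem theorem2:
  shows "(\<forall>a A :: real. a > 0 \<longrightarrow> A > 0 \<longrightarrow>
            (\<exists>c :: real. c > 0 \<and> (\<exists>N :: nat. \<forall>n \<ge> N. \<forall>m :: nat.
               a * ln (real n) \<le> real m \<and> real m \<le> A * real n powr (1/4) \<longrightarrow>
               (\<exists>F D. F \<subseteq> instances n \<and> (\<forall>(\<mu>, \<sigma>) \<in> F. order_stat n \<sigma> m \<le> 1) \<and>
                  distribution_on n F D \<and>
                  (\<forall>est. estimator n est \<longrightarrow>
                     expected_error n D est
                       \<ge> ennreal (c * (real n / real m ^ 4) powr (1/2)))))))
       \<and> (\<forall>\<epsilon> a A :: real. \<epsilon> > 0 \<longrightarrow> a > 0 \<longrightarrow> A > 0 \<longrightarrow>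
            (\<exists>c :: real. c > 0 \<and> (\<exists>N :: nat. \<forall>n \<ge> N. \<forall>m :: nat.
               a * real n powr (1/4) \<le> real m \<and> real m \<le> A * real n powr (1 - \<epsilon>) \<longrightarrow>
               (\<exists>F D. F \<subseteq> instances n \<and> (\<forall>(\<mu>, \<sigma>) \<in> F. order_stat n \<sigma> m \<le> 1) \<and>
                  distribution_on n F D \<and>
                  (\<forall>est. estimator n est \<longrightarrow>
                     expected_error n D est
                       \<ge> ennreal (c * (real n / real m ^ 4) powr (1/6)))))))"
proof (intro conjI allI impI, goal_cases)
  case (1 a A)
  \<comment> \<open>The constant \<open>c\<close> is absolute; \<open>a\<close> and \<open>A\<close>
    enter through \<open>N\<close>, beyond which the range of \<open>m\<close> implies the
    assumptions of \<open>lower_bound_small_m\<close>.\<close>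
  have "\<forall>\<^sub>F n::nat in sequentially. 4 \<le> a * ln (real n)"
    using 1 by real_asymp
  moreover have "\<forall>\<^sub>F n::nat in sequentially. 8 * (A * real n powr (1/4)) \<le> real n"
    using 1 by real_asymp
  moreover have "\<forall>\<^sub>F n::nat in sequentially. 4096 * (A * real n powr (1/4))\<^sup>2 < real n"
    using 1 by real_asymp
  ultimately have "\<forall>\<^sub>F n::nat in sequentially. 4 \<le> a * ln (real n) \<and>
      8 * (A * real n powr (1/4)) \<le> real n \<and> 4096 * (A * real n powr (1/4))\<^sup>2 < real n"
    by eventually_elim simp
  then obtain N where N: "4 \<le> a * ln (real n)" "8 * (A * real n powr (1/4)) \<le> real n"
      "4096 * (A * real n powr (1/4))\<^sup>2 < real n" if "N \<le> n" for n :: nat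
    unfolding eventually_sequentially by blast
  show ?case
  proof (intro exI[of _ "1 / 1048576"] conjI exI[of _ N] allI impI lower_bound_small_m)
    fix n m :: nat
    assume n: "N \<le> n" and m: "a * ln (real n) \<le> real m \<and> real m \<le> A * real n powr (1/4)"
    show "4 \<le> m" using N(1)[OF n] m by linarith
    show "8 * m \<le> n" using N(2)[OF n] m by linarith
    have "(real m)\<^sup>2 \<le> (A * real n powr (1/4))\<^sup>2" using m by (intro power_mono) auto
    then show "4096 * (real m)\<^sup>2 < real n" using N(3)[OF n] by linarith
  qed simp
next
  case (2 \<epsilon> a A)
  have "\<forall>\<^sub>F n::nat in sequentially. 4 \<le> a * real n powr (1/4)"
    using 2 by real_asymp
  \<comment> \<open>\<open>\<epsilon> > 0\<close> makes the upper end of the range of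
    \<open>m\<close> sublinear in \<open>n\<close>.\<close>
  moreover have "\<forall>\<^sub>F n::nat in sequentially. 8 * (A * real n powr (1 - \<epsilon>)) \<le> real n"
    using 2 by real_asymp
  ultimately have "\<forall>\<^sub>F n::nat in sequentially. 4 \<le> a * real n powr (1/4) \<and>
      8 * (A * real n powr (1 - \<epsilon>)) \<le> real n"
    by eventually_elim simp
  then obtain N where N: "4 \<le> a * real n powr (1/4)" "8 * (A * real n powr (1 - \<epsilon>)) \<le> real n"
      if "N \<le> n" for n :: nat
    unfolding eventually_sequentially by blast
  show ?case
  proof (intro exI[of _ "1 / 256"] conjI exI[of _ N] allI impI lower_bound_large_m)
    fix n m :: nat
    assume n: "N \<le> n" and m: "a * real n powr (1/4) \<le> real m \<and> real m \<le> A * real n powr (1 - \<epsilon>)"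
    show "4 \<le> m" using N(1)[OF n] m by linarith
    show "8 * m \<le> n" using N(2)[OF n] m by linarith
  qed simp
qed

end
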